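(* Fix $h\ge1$ and $c\in\{0,\ldots,h-1\}$. All leaves of a full ordered $r$-ary tree $T$ have depth congruent to $c$ modulo $h$ if and only if $T$ can be obtained from $P_{r,c}$ by repeatedly replacing a leaf with $P_{r,h}$. Hence every such tree has $$L(T)=r^c+t(r^h-1)\qquad(t\ge0),$$ and every $t\ge0$ occurs. The numerical condition alone does not determine the shape of $T$.
   Context: Fix an integer $r\ge2$. A full ordered $r$-ary tree is either a single leaf or a root with an ordered $r$-tuple of full ordered $r$-ary subtrees. $L(T)$ denotes the number of leaves of $T$. The depth of a vertex is its distance from the root. $P_{r,j}$ denotes the perfect full $r$-ary tree of height $j$, in which every leaf has depth $j$; in particular, $P_{r,0}$ is a single leaf. In the formula for $L(T)$, $t$ is an integer. *)

theory Defs
  imports "HOL-Number_Theory.Cong"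
begin

datatype otree = Leaf | Node "otree list"

fun full :: "nat \<Rightarrow> otree \<Rightarrow> bool" where
  "full r Leaf \<longleftrightarrow> True"
| "full r (Node ts) \<longleftrightarrow> length ts = r \<and> (\<forall>t\<in>set ts. full r t)"

text \<open>A vertex is represented by its address, the list of child indices on the path from the
  root to it; hence its depth (distance from the root) is the length of the address.\<close>

primrec leaves :: "otree \<Rightarrow> nat list set" where
  "leaves Leaf = {[]}"
| "leaves (Node ts) = (\<Union>i\<in>{..<length ts}. (#) i ` (map leaves ts ! i))"

definition depth :: "nat list \<Rightarrow> nat" where
  "depth v = length v"

definition num_leaves :: "otree \<Rightarrow> nat" where
  "num_leaves T = card (leaves T)"

definition all_leaves_cong :: "nat \<Rightarrow> nat \<Rightarrow> otree \<Rightarrow> bool" where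
  "all_leaves_cong h c T \<longleftrightarrow> (\<forall>v\<in>leaves T. [depth v = c] (mod h))"

primrec perfect :: "nat \<Rightarrow> nat \<Rightarrow> otree" where
  "perfect r 0 = Leaf"
| "perfect r (Suc j) = Node (replicate r (perfect r j))"

text \<open>\<open>replace_leaf S T T'\<close>: the tree \<open>T'\<close> arises from \<open>T\<close> by replacing exactly one leaf with \<open>S\<close>.\<close>

inductive replace_leaf :: "otree \<Rightarrow> otree \<Rightarrow> otree \<Rightarrow> bool" for S where
  root: "replace_leaf S Leaf S"
| child: "i < length ts \<Longrightarrow> replace_leaf S (ts ! i) t' \<Longrightarrow>
    replace_leaf S (Node ts) (Node (ts[i := t']))"

lemma full_perfect: "full r (perfect r j)"
  by (induction j) auto

lemma leaves_nonempty: "0 < r \<Longrightarrow> full r T \<Longrightarrow> leaves T \<noteq> {}"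
proof (induction T)
  case (Node ts)
  then have "0 < length ts" "leaves (ts ! 0) \<noteq> {}" by auto
  then show ?case by auto
qed simp

lemma full_all_depth_iff_perfect:
  assumes "0 < r" "full r T"
  shows "(\<forall>v\<in>leaves T. depth v = j) \<longleftrightarrow> T = perfect r j"
  using assms(2)
proof (induction j arbitrary: T)
  case 0
  show ?case
  proof (cases T)
    case (Node ts)
    have "leaves T \<noteq> {}" using leaves_nonempty[OF assms(1) 0] .
    then show ?thesis using Node by (fastforce simp: depth_def)
  qed (simp add: depth_def)
next
  case (Suc j)
  show ?case
  proof (cases T)
    case (Node ts)
    have len: "length ts = r" and f: "\<And>i. i < r \<Longrightarrow> full r (ts ! i)"
      using Suc.prems Node by auto
    have "(\<forall>v\<in>leaves T. depth v = Suc j) \<longleftrightarrow> (\<forall>i<r. \<forall>v\<in>leaves (ts ! i). depth v = j)"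
      using Node len by (auto simp: depth_def)
    also have "\<dots> \<longleftrightarrow> (\<forall>i<r. ts ! i = perfect r j)"
      using Suc.IH f by blast
    also have "\<dots> \<longleftrightarrow> ts = replicate r (perfect r j)"
      using len by (auto simp: list_eq_iff_nth_eq)
    finally show ?thesis using Node by simp
  qed (simp add: depth_def)
qed

end

theory Submission
  imports Defs
begin

text \<open>The equivalence reflects how the leaf condition recurses: cutting off the root lowers every
  leaf depth by one, so the subtrees at the children satisfy the condition with residue \<open>c - 1\<close>, or
  with residue \<open>h - 1\<close> if \<open>c = 0\<close>. Hence structural induction on the tree, with \<open>c\<close> varying, builds
  it from \<open>perfect r c\<close>: for \<open>c > 0\<close> the constructions of the subtrees from \<open>perfect r (c - 1)\<close> are
  carried out side by side below the root, while for \<open>c = 0\<close> a tree other than a leaf is reached by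
  first replacing the root by \<open>perfect r h\<close> (\<open>reachable_if_all_leaves_cong\<close>). Conversely, replacing
  a leaf at depth \<open>d\<close> by \<open>perfect r h\<close> puts new leaves at depth \<open>d + h\<close> only, which is the same
  residue (\<open>replace_leaf_depth_cong\<close>).

  Each replacement trades one leaf for \<open>r ^ h\<close> leaves, which gives the formula for the number of
  leaves; every \<open>t\<close> occurs because a full tree always has a leaf to replace.

  The number of leaves fails to determine the shape in two ways. Within the family, expanding a
  leaf below the first child or below the second child of one tree gives two different trees of the
  same size. Outside the family, every number \<open>r ^ c + t * (r ^ h - 1)\<close> has the form
  \<open>1 + k * (r - 1)\<close>, which is the size of a caterpillar, and for \<open>k \<ge> 2\<close> the caterpillar has
  leaves at the depths \<open>1\<close> and \<open>2\<close>, which are incongruent modulo \<open>h \<ge> 2\<close>.\<close>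

section \<open>Counting leaves\<close>

lemma finite_leaves: "finite (leaves T)"
  by (induction T) auto

lemma num_leaves_Leaf [simp]: "num_leaves Leaf = 1"
  by (simp add: num_leaves_def)

lemma num_leaves_Node [simp]: "num_leaves (Node ts) = sum_list (map num_leaves ts)"
proof -
  have "num_leaves (Node ts) = (\<Sum>i<length ts. card ((#) i ` leaves (ts ! i)))"
    unfolding num_leaves_def leaves.simps
    by (subst card_UN_disjoint) (auto simp: finite_leaves)
  also have "\<dots> = (\<Sum>i<length ts. num_leaves (ts ! i))"
    by (simp add: card_image num_leaves_def)
  also have "\<dots> = sum_list (map num_leaves ts)"
    by (simp add: sum_list_sum_nth atLeast0LessThan)
  finally show ?thesis .
qed

lemma num_leaves_perfect [simp]: "num_leaves (perfect r j) = r ^ j"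
  by (induction j) (simp_all add: sum_list_replicate)

section \<open>Replacing a leaf\<close>

lemma num_leaves_replace_leaf:
  "replace_leaf S T T' \<Longrightarrow> num_leaves T' + 1 = num_leaves T + num_leaves S"
proof (induction rule: replace_leaf.induct)
  case (child i ts t')
  have "num_leaves (ts ! i) \<le> sum_list (map num_leaves ts)"
    using child.hyps(1) by (intro member_le_sum_list) auto
  then show ?case
    using child by (simp add: map_update sum_list_update)
qed simp

lemma full_replace_leaf: "replace_leaf S T T' \<Longrightarrow> full r S \<Longrightarrow> full r T \<Longrightarrow> full r T'"
  by (induction rule: replace_leaf.induct) (auto dest: set_update_subset_insert[THEN subsetD])

lemma ex_replace_leaf: "0 < r \<Longrightarrow> full r T \<Longrightarrow> \<exists>T'. replace_leaf S T T'"
proof (induction T)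
  case Leaf
  show ?case by (blast intro: replace_leaf.root)
next
  case (Node ts)
  then have "ts ! 0 \<in> set ts" "0 < length ts" by auto
  with Node show ?case by (fastforce intro: replace_leaf.child)
qed

text \<open>The offset \<open>d\<close> stands for the depth, in a surrounding tree, of the root of the tree at hand; it
  is what makes the statement inductive.\<close>

lemma replace_leaf_depth_cong:
  assumes "replace_leaf S T T'" and "\<forall>v\<in>leaves S. [depth v = 0] (mod h)"
    and "\<forall>v\<in>leaves T. [d + depth v = c] (mod h)"
  shows "\<forall>v\<in>leaves T'. [d + depth v = c] (mod h)"
  using assms(1,3)
proof (induction arbitrary: d rule: replace_leaf.induct)
  case root
  have "[d + depth v = d + 0] (mod h)" if "v \<in> leaves S" for v
    using assms(2) that by (intro cong_add) auto
  then show ?case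
    using root by (auto simp: depth_def intro: cong_trans)
next
  case (child i ts t')
  have old: "\<forall>v\<in>leaves (ts ! j). [Suc d + depth v = c] (mod h)" if "j < length ts" for j
    using child.prems that by (auto simp: depth_def)
  have new: "\<forall>v\<in>leaves t'. [Suc d + depth v = c] (mod h)"
    using child.IH old[OF child.hyps(1)] .
  show ?case
  proof
    fix v assume "v \<in> leaves (Node (ts[i := t']))"
    then obtain j w where "j < length ts" "v = j # w" "w \<in> leaves (ts[i := t'] ! j)"
      by auto
    then show "[d + depth v = c] (mod h)"
      using old[of j] new by (cases "j = i") (auto simp: depth_def)
  qed
qed

lemma replace_leaf_star_child:
  assumes "(replace_leaf S)\<^sup>*\<^sup>* s t"
  shows "(replace_leaf S)\<^sup>*\<^sup>* (Node (us @ s # vs)) (Node (us @ t # vs))"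
  using assms
proof (induction rule: rtranclp_induct)
  case (step t t')
  have "replace_leaf S (Node (us @ t # vs)) (Node (us @ t' # vs))"
    using replace_leaf.child[of "length us" "us @ t # vs" S t'] step.hyps(2) by simp
  with step.IH show ?case by (rule rtranclp.rtrancl_into_rtrancl)
qed simp

lemma replace_leaf_star_children:
  assumes "list_all2 (replace_leaf S)\<^sup>*\<^sup>* ss ts"
  shows "(replace_leaf S)\<^sup>*\<^sup>* (Node ss) (Node ts)"
proof -
  \<comment> \<open>The children are transformed from left to right; \<open>us\<close> collects those already done.\<close>
  have "(replace_leaf S)\<^sup>*\<^sup>* (Node (us @ ss)) (Node (us @ ts))" for us
    using assms
  proof (induction arbitrary: us rule: list_all2_induct)
    case (Cons s ss t ts)
    have "(replace_leaf S)\<^sup>*\<^sup>* (Node (us @ s # ss)) (Node (us @ t # ss))"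
      by (rule replace_leaf_star_child) (rule Cons.hyps)
    also have "(replace_leaf S)\<^sup>*\<^sup>* \<dots> (Node (us @ t # ts))"
      using Cons.IH[of "us @ [t]"] by simp
    finally show ?case .
  qed simp
  from this[of "[]"] show ?thesis by simp
qed

section \<open>Leaf depths in a fixed residue class\<close>

lemma all_leaves_cong_perfect: "0 < r \<Longrightarrow> all_leaves_cong h j (perfect r j)"
  using full_all_depth_iff_perfect[OF _ full_perfect, THEN iffD2, OF _ refl]
  by (simp add: all_leaves_cong_def)

lemma all_leaves_cong_if_reachable:
  assumes "0 < r" "(replace_leaf (perfect r h))\<^sup>*\<^sup>* (perfect r c) T"
  shows "all_leaves_cong h c T"
  using assms(2)
proof (induction rule: rtranclp_induct)
  case base
  show ?case using assms(1) by (rule all_leaves_cong_perfect)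
next
  case (step T T')
  have "\<forall>v\<in>leaves (perfect r h). [depth v = 0] (mod h)"
    using all_leaves_cong_perfect[OF assms(1), of h h]
    by (auto simp: all_leaves_cong_def cong_def)
  from replace_leaf_depth_cong[OF step.hyps(2) this, of 0 c] step.IH
  show ?case by (simp add: all_leaves_cong_def)
qed

text \<open>Residues are taken in \<open>{..<h}\<close>, so the residue below the root is \<open>c - 1\<close>, or \<open>h - 1\<close> for
  \<open>c = 0\<close>. The latter case is where an expansion step is used up, since \<open>perfect r h\<close> consists of
  copies of \<open>perfect r (h - 1)\<close> below a root.\<close>

lemma reachable_if_all_leaves_cong:
  assumes "full r T" "all_leaves_cong h c T" "c < h"
  shows "(replace_leaf (perfect r h))\<^sup>*\<^sup>* (perfect r c) T"
  using assms
proof (induction T arbitrary: c)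
  case Leaf
  then have "c = 0"
    by (simp add: all_leaves_cong_def depth_def cong_def)
  then show ?case by simp
next
  case (Node ts)
  have len: "length ts = r" using Node.prems by simp
  have below_root: "(replace_leaf (perfect r h))\<^sup>*\<^sup>* (perfect r (Suc b)) (Node ts)"
    if "b < h" and b: "[Suc b = c] (mod h)" for b
  proof -
    have "(replace_leaf (perfect r h))\<^sup>*\<^sup>* (perfect r b) (ts ! i)" if i: "i < r" for i
    proof (rule Node.IH)
      show "ts ! i \<in> set ts" "full r (ts ! i)" "b < h"
        using i len Node.prems \<open>b < h\<close> by auto
      have "[Suc (depth v) = Suc b] (mod h)" if "v \<in> leaves (ts ! i)" for v
      proof -
        have "i # v \<in> leaves (Node ts)" using that i len by auto
        then have "[depth (i # v) = c] (mod h)"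
          using Node.prems(2) unfolding all_leaves_cong_def by blast
        then show ?thesis
          using b by (simp add: depth_def cong_def)
      qed
      then show "all_leaves_cong h b (ts ! i)"
        unfolding all_leaves_cong_def
        using cong_add_lcancel_nat[of 1 _ b h] by simp
    qed
    then show ?thesis
      using len by (auto intro!: replace_leaf_star_children simp: list_all2_conv_all_nth)
  qed
  show ?case
  proof (cases c)
    case 0
    have "replace_leaf (perfect r h) (perfect r c) (perfect r h)"
      using 0 by (simp add: replace_leaf.root)
    also have "(replace_leaf (perfect r h))\<^sup>*\<^sup>* \<dots> (Node ts)"
      using below_root[of "h - 1"] 0 Node.prems(3) by (simp add: cong_def)
    finally show ?thesis .
  next
    case (Suc b)
    then show ?thesis using below_root[of b] Node.prems(3) by simp
  qed
qed

section \<open>The number of leaves\<close>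

lemma num_leaves_reachable:
  assumes "(replace_leaf (perfect r h))\<^sup>*\<^sup>* (perfect r c) T"
  shows "\<exists>t::nat. int (num_leaves T) = int r ^ c + int t * (int r ^ h - 1)"
  using assms
proof (induction rule: rtranclp_induct)
  case base
  show ?case by (rule exI[of _ 0]) simp
next
  case (step T T')
  then obtain t :: nat where "int (num_leaves T) = int r ^ c + int t * (int r ^ h - 1)"
    by blast
  moreover have "int (num_leaves T') + 1 = int (num_leaves T) + int r ^ h"
    using arg_cong[OF num_leaves_replace_leaf[OF step.hyps(2)], of int] by simp
  ultimately show ?case
    by (intro exI[of _ "Suc t"]) (simp add: algebra_simps)
qed

lemma ex_reachable_num_leaves:
  fixes t :: nat
  assumes "0 < r"
  shows "\<exists>T. full r T \<and> (replace_leaf (perfect r h))\<^sup>*\<^sup>* (perfect r c) T \<and>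
    int (num_leaves T) = int r ^ c + int t * (int r ^ h - 1)"
proof (induction t)
  case 0
  show ?case by (rule exI[of _ "perfect r c"]) (simp add: full_perfect)
next
  case (Suc t)
  then obtain T where T: "full r T" "(replace_leaf (perfect r h))\<^sup>*\<^sup>* (perfect r c) T"
    "int (num_leaves T) = int r ^ c + int t * (int r ^ h - 1)" by blast
  obtain T' where T': "replace_leaf (perfect r h) T T'"
    using ex_replace_leaf[OF assms T(1)] by blast
  have "int (num_leaves T') + 1 = int (num_leaves T) + int r ^ h"
    using arg_cong[OF num_leaves_replace_leaf[OF T'], of int] by simp
  then have "int (num_leaves T') = int r ^ c + int (Suc t) * (int r ^ h - 1)"
    using T(3) by (simp add: algebra_simps)
  moreover have "full r T'"
    using full_replace_leaf[OF T' full_perfect T(1)] .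
  moreover have "(replace_leaf (perfect r h))\<^sup>*\<^sup>* (perfect r c) T'"
    using T(2) T' by (rule rtranclp.rtrancl_into_rtrancl)
  ultimately show ?case by blast
qed

section \<open>Trees of equal size and different shape\<close>

text \<open>Replacing a leaf by a tree with at least two leaves changes the number of leaves of the child in
  which it happens. So replacements under different children of the root have different results.\<close>

lemma ex_distinct_replace_leaf:
  assumes "2 \<le> r" "full r T" "T \<noteq> Leaf" "2 \<le> num_leaves S"
  shows "\<exists>T' T''. replace_leaf S T T' \<and> replace_leaf S T T'' \<and> T' \<noteq> T''"
proof -
  obtain ts where T: "T = Node ts" using assms(3) by (cases T) auto
  have len: "0 < length ts" "1 < length ts" using assms(1,2) T by auto
  have full: "full r (ts ! 0)" "full r (ts ! 1)" using assms(2) len T by auto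
  obtain a b where ab: "replace_leaf S (ts ! 0) a" "replace_leaf S (ts ! 1) b"
    using ex_replace_leaf full assms(1) by (metis zero_less_numeral less_le_trans)
  have "a \<noteq> ts ! 0"
    using num_leaves_replace_leaf[OF ab(1)] assms(4) by auto
  then have "ts[0 := a] ! 0 \<noteq> ts[1 := b] ! 0" using len by simp
  then have "Node (ts[0 := a]) \<noteq> Node (ts[1 := b])" by auto
  then show ?thesis
    using replace_leaf.child[OF len(1) ab(1)] replace_leaf.child[OF len(2) ab(2)] T by blast
qed

text \<open>The tree with \<open>k\<close> internal vertices, all on the path through first children.\<close>

primrec caterpillar :: "nat \<Rightarrow> nat \<Rightarrow> otree" where
  "caterpillar r 0 = Leaf"
| "caterpillar r (Suc k) = Node (caterpillar r k # replicate (r - 1) Leaf)"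

lemma full_caterpillar: "0 < r \<Longrightarrow> full r (caterpillar r k)"
  by (induction k) auto

lemma num_leaves_caterpillar: "num_leaves (caterpillar r k) = 1 + k * (r - 1)"
  by (induction k) (simp_all add: sum_list_replicate)

lemma leaves_caterpillar_Suc:
  assumes "2 \<le> r"
  shows "[1] \<in> leaves (caterpillar r (Suc k))"
    and "v \<in> leaves (caterpillar r k) \<Longrightarrow> 0 # v \<in> leaves (caterpillar r (Suc k))"
  using assms by (force simp: nth_Cons')+

lemma not_all_leaves_cong_caterpillar:
  assumes "2 \<le> r" "2 \<le> h" "2 \<le> k"
  shows "\<not> all_leaves_cong h c (caterpillar r k)"
proof
  assume *: "all_leaves_cong h c (caterpillar r k)"
  obtain k' where k: "k = Suc (Suc k')"
    using assms(3) by (metis Suc_le_D numeral_2_eq_2 Suc_le_mono)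
  have "[1] \<in> leaves (caterpillar r k)" "[0, 1] \<in> leaves (caterpillar r k)"
    unfolding k using leaves_caterpillar_Suc[OF assms(1)] by blast+
  with * have "[depth [1] = c] (mod h)" "[depth [0, 1] = c] (mod h)"
    unfolding all_leaves_cong_def by blast+
  then have "[1 + 0 = 1 + 1] (mod h)"
    by (simp add: depth_def cong_def)
  then have "[0 = 1] (mod h)"
    by (simp only: cong_add_lcancel_nat)
  then show False
    using assms(2) by (simp add: cong_def)
qed

lemma power_eq_1_plus_mult: "\<exists>k. r ^ n = 1 + k * (r - 1)" if "0 < r" for r n :: nat
proof -
  obtain s where "r = Suc s" using \<open>0 < r\<close> by (cases r) auto
  moreover have "\<exists>k. Suc s ^ n = 1 + k * s"
  proof (induction n)
    case (Suc n)
    then obtain k where "Suc s ^ n = 1 + k * s" by blast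
    then have "Suc s ^ Suc n = 1 + (k + k * s + 1) * s"
      by (simp add: algebra_simps)
    then show ?case by blast
  qed simp
  ultimately show ?thesis by simp
qed

text \<open>Both \<open>r ^ c\<close> and \<open>r ^ h\<close> are \<open>1\<close> modulo \<open>r - 1\<close>, so for \<open>t = 1\<close> the required number of
  leaves is that of a caterpillar. As \<open>h \<ge> 2\<close>, this caterpillar has at least two internal vertices.\<close>

lemma ex_num_leaves_not_all_leaves_cong:
  assumes "2 \<le> r" "2 \<le> h"
  shows "\<exists>T. full r T \<and> \<not> all_leaves_cong h c T \<and>
    int (num_leaves T) = int r ^ c + (int r ^ h - 1)"
proof -
  obtain a b where a: "r ^ c = 1 + a * (r - 1)" and b: "r ^ h = 1 + b * (r - 1)"
    using power_eq_1_plus_mult[of r] assms(1) by fastforce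
  have "2 \<le> b"
  proof (rule ccontr)
    assume "\<not> 2 \<le> b"
    then have "b * (r - 1) \<le> 1 * (r - 1)" by (intro mult_right_mono) auto
    with b have "r ^ h \<le> 1 + (r - 1)" by linarith
    then have "r ^ h \<le> r ^ 1" using assms(1) by simp
    then show False using assms by (subst (asm) power_increasing_iff) auto
  qed
  have "num_leaves (caterpillar r (a + b)) + 1 = r ^ c + r ^ h"
    by (simp add: num_leaves_caterpillar a b add_mult_distrib)
  then have "int (num_leaves (caterpillar r (a + b)) + 1) = int (r ^ c + r ^ h)"
    by (rule arg_cong)
  then have "int (num_leaves (caterpillar r (a + b))) = int r ^ c + (int r ^ h - 1)"
    by simp
  moreover have "\<not> all_leaves_cong h c (caterpillar r (a + b))"
    using assms \<open>2 \<le> b\<close> by (intro not_all_leaves_cong_caterpillar) auto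
  moreover have "full r (caterpillar r (a + b))"
    using assms(1) by (simp add: full_caterpillar)
  ultimately show ?thesis by blast
qed

theorem proposition3p9:
  fixes r h c :: nat
  assumes "2 \<le> r" and "1 \<le> h" and "c \<in> {0..h - 1}"
  shows "(\<forall>T. full r T \<longrightarrow>
      (all_leaves_cong h c T \<longleftrightarrow> (replace_leaf (perfect r h))\<^sup>*\<^sup>* (perfect r c) T)) \<and>
    (\<forall>T. full r T \<and> all_leaves_cong h c T \<longrightarrow>
      (\<exists>t::int. 0 \<le> t \<and> int (num_leaves T) = int r ^ c + t * (int r ^ h - 1))) \<and>
    (\<forall>t::int. 0 \<le> t \<longrightarrow>
      (\<exists>T. full r T \<and> all_leaves_cong h c T \<and>
        int (num_leaves T) = int r ^ c + t * (int r ^ h - 1))) \<and>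
    (\<exists>t::int. 0 \<le> t \<and> (\<exists>T T'. T \<noteq> T' \<and>
        full r T \<and> all_leaves_cong h c T \<and> full r T' \<and> all_leaves_cong h c T' \<and>
        int (num_leaves T) = int r ^ c + t * (int r ^ h - 1) \<and>
        int (num_leaves T') = int r ^ c + t * (int r ^ h - 1))) \<and>
    (2 \<le> h \<longrightarrow> (\<exists>t::int. 0 \<le> t \<and> (\<exists>T. full r T \<and> \<not> all_leaves_cong h c T \<and>
        int (num_leaves T) = int r ^ c + t * (int r ^ h - 1))))"
proof -
  have r: "0 < r" and ch: "c < h" using assms by auto
  have char: "all_leaves_cong h c T \<longleftrightarrow> (replace_leaf (perfect r h))\<^sup>*\<^sup>* (perfect r c) T"
    if "full r T" for T
    using reachable_if_all_leaves_cong[OF that _ ch] all_leaves_cong_if_reachable[OF r] by blast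
  have count: "\<exists>t::int. 0 \<le> t \<and> int (num_leaves T) = int r ^ c + t * (int r ^ h - 1)"
    if "full r T" "all_leaves_cong h c T" for T
    using num_leaves_reachable char that by (meson of_nat_0_le_iff)
  have occurs: "\<exists>T. full r T \<and> all_leaves_cong h c T \<and>
      int (num_leaves T) = int r ^ c + t * (int r ^ h - 1)" if "0 \<le> t" for t :: int
    using ex_reachable_num_leaves[OF r, of h c "nat t"] char that by auto
  have r_le: "r \<le> r ^ h" using self_le_power[of r h] r assms(2) by simp
  have shapes: "\<exists>T T'. T \<noteq> T' \<and>
      full r T \<and> all_leaves_cong h c T \<and> full r T' \<and> all_leaves_cong h c T' \<and>
      int (num_leaves T) = int r ^ c + 2 * (int r ^ h - 1) \<and>
      int (num_leaves T') = int r ^ c + 2 * (int r ^ h - 1)"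
  proof -
    \<comment> \<open>Starting from \<open>t = 1\<close> guarantees a tree with more than one leaf even if \<open>c = 0\<close>.\<close>
    obtain T where T: "full r T" "(replace_leaf (perfect r h))\<^sup>*\<^sup>* (perfect r c) T"
      "int (num_leaves T) = int r ^ c + (int r ^ h - 1)"
      using ex_reachable_num_leaves[OF r, of h c 1] by auto
    have "num_leaves T + 1 = r ^ c + r ^ h"
      using T(3) by (simp flip: of_nat_power)
    moreover have "0 < r ^ c" using r by simp
    ultimately have "2 \<le> num_leaves T" using r_le assms(1) by linarith
    then have "T \<noteq> Leaf" by auto
    then obtain T' T'' where T': "replace_leaf (perfect r h) T T'" "replace_leaf (perfect r h) T T''"
      and ne: "T' \<noteq> T''"
      using ex_distinct_replace_leaf[OF assms(1) T(1), of "perfect r h"] r_le assms(1) by auto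
    have "full r U \<and> all_leaves_cong h c U \<and>
        int (num_leaves U) = int r ^ c + 2 * (int r ^ h - 1)"
      if U: "replace_leaf (perfect r h) T U" for U
    proof (intro conjI)
      show "full r U" using full_replace_leaf[OF U full_perfect T(1)] .
      show "all_leaves_cong h c U"
        using all_leaves_cong_if_reachable[OF r] T(2) U by (meson rtranclp.rtrancl_into_rtrancl)
      show "int (num_leaves U) = int r ^ c + 2 * (int r ^ h - 1)"
        using arg_cong[OF num_leaves_replace_leaf[OF U], of int] T(3) by simp
    qed
    with T' ne show ?thesis by blast
  qed
  have "\<exists>t::int. 0 \<le> t \<and> (\<exists>T. full r T \<and> \<not> all_leaves_cong h c T \<and>
      int (num_leaves T) = int r ^ c + t * (int r ^ h - 1))" if "2 \<le> h"
    using ex_num_leaves_not_all_leaves_cong[OF assms(1) that, of c] by (intro exI[of _ 1]) simp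
  moreover have "\<exists>t::int. 0 \<le> t \<and> (\<exists>T T'. T \<noteq> T' \<and>
      full r T \<and> all_leaves_cong h c T \<and> full r T' \<and> all_leaves_cong h c T' \<and>
      int (num_leaves T) = int r ^ c + t * (int r ^ h - 1) \<and>
      int (num_leaves T') = int r ^ c + t * (int r ^ h - 1))"
    using shapes by (intro exI[of _ 2]) simp
  ultimately show ?thesis
    using char count occurs by blast
qed

end
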